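(* Let $m\ge3$ be odd, $q=2^i$ with $\gcd(i,m)=1$, and for $a\in\mathbb{F}_{2^m}^*$ let \[G_a(x,y,z)=\bigl(x^{q+1}+ax^qz+yz^q,\; x^qz+y^{q+1},\; xy^q+ay^qz+z^{q+1}\bigr),\] \[H_a(x,y,z)=\bigl(x^{q+1}+axy^q+yz^q,\; xy^q+z^{q+1},\; x^qz+y^{q+1}+ay^qz\bigr).\] For $a\in\mathbb{F}_{2^m}^*$ the following are equivalent: (i) $G_1=A_1\circ G_a\circ A_2$ for some diagonal $\mathbb{F}_{2^m}$-linear bijections $A_1,A_2$ of $\mathbb{F}_{2^m}^3$; (ii) $H_1=A_1\circ H_a\circ A_2$ for some diagonal $\mathbb{F}_{2^m}$-linear bijections $A_1,A_2$ of $\mathbb{F}_{2^m}^3$; (iii) $a^{q^2+q+1}=1$. Hence the set of $a\in\mathbb{F}_{2^m}^*$ for which $G_a$ is diagonally equivalent to $G_1$, or $H_a$ is diagonally equivalent to $H_1$, is the subgroup $\{a\in\mathbb{F}_{2^m}^*: a^{q^2+q+1}=1\}$, of order $d_0=\gcd(q^2+q+1,2^m-1)$. Consequently, letting $\mathcal B_{m,q}=\{a\in\mathbb{F}_{2^m}^*: T^{q^2+q+1}+aT+1\text{ has no root in }\mathbb{F}_{2^m}^*\}$, whenever $|\mathcal B_{m,q}|>d_0$ there exist $a\in\mathcal B_{m,q}$ such that both $G_a$ and $H_a$ are APN permutations of $\mathbb{F}_{2^m}^3$ but neither $G_a$ is diagonally equivalent to $G_1$ nor $H_a$ to $H_1$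.
   Context: A diagonal $\mathbb{F}_{2^m}$-linear bijection of $\mathbb{F}_{2^m}^3$ is a map $(x,y,z)\mapsto(\lambda_1x,\lambda_2y,\lambda_3z)$ with $\lambda_1,\lambda_2,\lambda_3\in\mathbb{F}_{2^m}^*$. A function $F:\mathbb{F}_{2^m}^n\to\mathbb{F}_{2^m}^n$ is APN if for every nonzero $\mathbf u$ and every $\mathbf b$, the equation $F(\mathbf x+\mathbf u)+F(\mathbf x)=\mathbf b$ has at most two solutions. *)

theory Defs
  imports
    "HOL-Library.Cardinality"
    "HOL-Library.Product_Plus"
    "HOL-Algebra.Multiplicative_Group"
    "HOL-Algebra.Algebraic_Closure_Type"
begin

text \<open>
  The field with \<open>2 ^ m\<close> elements is a type \<open>'a :: {field, finite}\<close> with \<open>CARD('a) = 2 ^ m\<close>, which fixes it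
  up to isomorphism, and its third Cartesian power is \<open>'a \<times> 'a \<times> 'a\<close> with componentwise addition.
\<close>

definition Gmap :: "nat \<Rightarrow> 'a::field \<Rightarrow> 'a \<times> 'a \<times> 'a \<Rightarrow> 'a \<times> 'a \<times> 'a" where
  "Gmap q a = (\<lambda>(x, y, z).
     (x ^ (q + 1) + a * x ^ q * z + y * z ^ q,
      x ^ q * z + y ^ (q + 1),
      x * y ^ q + a * y ^ q * z + z ^ (q + 1)))"

definition Hmap :: "nat \<Rightarrow> 'a::field \<Rightarrow> 'a \<times> 'a \<times> 'a \<Rightarrow> 'a \<times> 'a \<times> 'a" where
  "Hmap q a = (\<lambda>(x, y, z).
     (x ^ (q + 1) + a * x * y ^ q + y * z ^ q,
      x * y ^ q + z ^ (q + 1),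
      x ^ q * z + y ^ (q + 1) + a * y ^ q * z))"

definition diagonal_bijection :: "('a::field \<times> 'a \<times> 'a \<Rightarrow> 'a \<times> 'a \<times> 'a) \<Rightarrow> bool" where
  "diagonal_bijection A \<longleftrightarrow>
     (\<exists>l1 l2 l3. l1 \<noteq> 0 \<and> l2 \<noteq> 0 \<and> l3 \<noteq> 0 \<and> A = (\<lambda>(x, y, z). (l1 * x, l2 * y, l3 * z)))"

definition diag_equiv ::
  "('a::field \<times> 'a \<times> 'a \<Rightarrow> 'a \<times> 'a \<times> 'a) \<Rightarrow> ('a \<times> 'a \<times> 'a \<Rightarrow> 'a \<times> 'a \<times> 'a) \<Rightarrow> bool" where
  "diag_equiv F F' \<longleftrightarrow>
     (\<exists>A\<^sub>1 A\<^sub>2. diagonal_bijection A\<^sub>1 \<and> diagonal_bijection A\<^sub>2 \<and> F' = A\<^sub>1 \<circ> F \<circ> A\<^sub>2)"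

text \<open>
  The sum \<open>F (x + u) + F x\<close>, rather than a difference, is the convention for characteristic two.
\<close>

definition APN :: "('v::{finite, ab_group_add} \<Rightarrow> 'v) \<Rightarrow> bool" where
  "APN F \<longleftrightarrow> (\<forall>u b. u \<noteq> 0 \<longrightarrow> card {x. F (x + u) + F x = b} \<le> 2)"

definition Bset :: "nat \<Rightarrow> 'a::field set" where
  "Bset q = {a. a \<noteq> 0 \<and> \<not> (\<exists>T. T \<noteq> 0 \<and> T ^ (q\<^sup>2 + q + 1) + a * T + 1 = 0)}"

end

theory Submission
  imports Defs
begin

text \<open>
  Up to an invertible linear map, \<open>Gmap q a\<close> and \<open>Hmap q a\<close> have the form \<open>u \<mapsto> f u \<times> u\<close> with a cross
  product and a map \<open>f\<close> of the three-dimensional space that is semilinear for the Frobenius map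
  \<open>t \<mapsto> t ^ q\<close>. An invariant line or plane of \<open>f\<close> gives a root of \<open>T ^ (q\<^sup>2 + q + 1) + a T + 1\<close>; thus,
  if there is no root, \<open>u\<close>, \<open>f u\<close>, \<open>f (f u)\<close> are independent for every \<open>u \<noteq> 0\<close>. Then
  \<open>f x \<times> u + f u \<times> x = \<delta> (f u \<times> u)\<close> forces \<open>x = \<alpha> u\<close> with \<open>\<alpha> ^ q + \<alpha> = \<delta>\<close>. For \<open>\<delta> = 0\<close> the solutions
  are \<open>\<alpha> = 0\<close> and \<open>\<alpha> = 1\<close>, which is the APN property; for \<open>\<delta> = 1\<close> there are none since \<open>m\<close> is odd,
  which is injectivity. The diagonal equivalences are found by comparing coefficients.
\<close>

section \<open>Cross products\<close>

definition cross :: "'a::comm_ring_1 \<times> 'a \<times> 'a \<Rightarrow> 'a \<times> 'a \<times> 'a \<Rightarrow> 'a \<times> 'a \<times> 'a" where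
  "cross = (\<lambda>(x, y, z) (x', y', z'). (y * z' - z * y', z * x' - x * z', x * y' - y * x'))"

definition dot :: "'a::comm_ring_1 \<times> 'a \<times> 'a \<Rightarrow> 'a \<times> 'a \<times> 'a \<Rightarrow> 'a" where
  "dot = (\<lambda>(x, y, z) (x', y', z'). x * x' + y * y' + z * z')"

definition scale :: "'a::comm_ring_1 \<Rightarrow> 'a \<times> 'a \<times> 'a \<Rightarrow> 'a \<times> 'a \<times> 'a" where
  "scale c = (\<lambda>(x, y, z). (c * x, c * y, c * z))"

lemmas vector_defs = cross_def dot_def scale_def zero_prod_def

lemma cross_add:
  "cross (u + v) w = cross u w + cross v w" "cross u (v + w) = cross u v + cross u w"
  by (cases u rule: prod_cases3; cases v rule: prod_cases3; cases w rule: prod_cases3;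
      simp add: vector_defs algebra_simps)+

lemma cross_scale:
  "cross (scale c u) v = scale c (cross u v)" "cross u (scale c v) = scale c (cross u v)"
  by (cases u rule: prod_cases3; cases v rule: prod_cases3; simp add: vector_defs algebra_simps)+

lemma dot_add: "dot u (v + w) = dot u v + dot u w"
  by (cases u rule: prod_cases3; cases v rule: prod_cases3; cases w rule: prod_cases3;
      simp add: vector_defs algebra_simps)

lemma dot_scale: "dot u (scale c v) = c * dot u v"
  by (cases u rule: prod_cases3; cases v rule: prod_cases3; simp add: vector_defs algebra_simps)

lemma scale_add: "scale (c + d) u = scale c u + scale d u" "scale c (u + v) = scale c u + scale c v"
  by (cases u rule: prod_cases3; cases v rule: prod_cases3; simp add: vector_defs algebra_simps)+

lemma scale_scale: "scale c (scale d u) = scale (c * d) u"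
  by (cases u rule: prod_cases3; simp add: vector_defs algebra_simps)

lemma scale_simps [simp]: "scale 0 u = 0" "scale 1 u = u" "scale c 0 = 0"
  by (auto simp: vector_defs split: prod.splits)

lemma scale_eq_0_iff [simp]: "scale (c::'a::field) u = 0 \<longleftrightarrow> c = 0 \<or> u = 0"
  by (auto simp: vector_defs split: prod.splits)

lemma dot_cross_self [simp]:
  "dot u (cross u v) = 0" "dot v (cross u v) = 0" "dot (cross u v) u = 0" "dot (cross u v) v = 0"
  by (cases u rule: prod_cases3; cases v rule: prod_cases3; simp add: vector_defs algebra_simps)+

lemma cross_self [simp]: "cross u u = 0"
  by (cases u rule: prod_cases3; simp add: vector_defs algebra_simps)

lemma dot_cross_rotate: "dot u (cross v w) = dot (cross u v) w"
  by (cases u rule: prod_cases3; cases v rule: prod_cases3; cases w rule: prod_cases3;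
      simp add: vector_defs algebra_simps)

lemma dot_cross_cyclic: "dot (cross u v) w = dot (cross v w) u"
  by (cases u rule: prod_cases3; cases v rule: prod_cases3; cases w rule: prod_cases3;
      simp add: vector_defs algebra_simps)

lemma cross_cross: "cross p (cross u v) = scale (dot p v) u - scale (dot p u) v"
  by (cases u rule: prod_cases3; cases v rule: prod_cases3; cases p rule: prod_cases3;
      simp add: vector_defs algebra_simps)

text \<open>\<open>dot (cross u v) w\<close> is the determinant of the three vectors. Without
  division this is a polynomial identity, valid over any commutative ring.\<close>

lemma cramer:
  "scale (dot (cross u v) w) x =
     scale (dot (cross x v) w) u + scale (dot (cross u x) w) v + scale (dot (cross u v) x) w"
  by (cases u rule: prod_cases3; cases v rule: prod_cases3; cases w rule: prod_cases3; cases x rule: prod_cases3;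
      simp add: vector_defs algebra_simps)

lemma cross_eq_0_imp_scale:
  fixes u v :: "'a::field \<times> 'a \<times> 'a"
  assumes "cross u v = 0" "v \<noteq> 0" shows "\<exists>c. u = scale c v"
proof -
  obtain x y z x' y' z' where uv: "u = (x, y, z)" "v = (x', y', z')"
    by (metis prod_cases3)
  have eqs: "y * z' = z * y'" "z * x' = x * z'" "x * y' = y * x'"
    using assms(1) by (simp_all add: uv vector_defs)
  consider "x' \<noteq> 0" | "y' \<noteq> 0" | "z' \<noteq> 0" using assms(2) by (auto simp: uv vector_defs)
  then show ?thesis
  proof cases
    case 1
    then show ?thesis using eqs by (intro exI[of _ "x / x'"]) (simp add: uv vector_defs field_simps)
  next
    case 2
    then show ?thesis using eqs by (intro exI[of _ "y / y'"]) (simp add: uv vector_defs field_simps)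
  next
    case 3
    then show ?thesis using eqs by (intro exI[of _ "z / z'"]) (simp add: uv vector_defs field_simps)
  qed
qed

section \<open>Finite fields of characteristic two\<close>

text \<open>Multiplication by \<open>x\<close> permutes the nonzero elements, so it leaves their
  nonzero product unchanged.\<close>

lemma pow_card_minus_one:
  assumes "(x::'a::{field, finite}) \<noteq> 0" shows "x ^ (CARD('a) - 1) = 1"
proof -
  have "bij_betw ((*) x) (UNIV - {0}) (UNIV - {0})"
    by (rule bij_betw_byWitness[where f' = "\<lambda>y. y / x"]) (use assms in auto)
  from prod.reindex_bij_betw[OF this, of id]
  have "x ^ card (UNIV - {0::'a}) * (\<Prod>y\<in>UNIV - {0}. y) = (\<Prod>y\<in>UNIV - {0}. y)"
    by (simp add: prod.distrib)
  then show ?thesis by (simp add: card_Diff_singleton)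
qed

locale binary_field =
  fixes m i q :: nat and ty :: "'a::{field, finite} itself"
  assumes card: "CARD('a) = 2 ^ m" and odd_m: "odd m"
    and q_def: "q = 2 ^ i" and coprime_i_m: "coprime i m"
begin

lemma pow_card: "(x::'a) ^ (2 ^ m) = x"
proof (cases "x = 0")
  case False
  then have "x * x ^ (2 ^ m - 1) = x" using pow_card_minus_one[of x] by (simp add: card)
  then show ?thesis by (simp flip: power_Suc)
qed (simp add: power_0_left)

lemma char_two: "(x::'a) + x = 0"
proof -
  \<comment> \<open>The exponent is even because \<open>m > 0\<close>, while \<open>pow_card\<close>
    makes the same power equal to \<open>-1\<close>.\<close>
  have "(-1::'a) ^ (2 ^ m) = 1"
    using odd_m by (cases m) auto
  with pow_card[of "-1"] have "(1::'a) + 1 = 0"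
    by (metis add.right_inverse)
  then show ?thesis
    by (metis distrib_left mult.right_neutral mult_zero_right)
qed

lemma two_eq_zero [simp]: "(2::'a) = 0"
  using char_two[of 1] by (simp only: one_add_one)

lemma minus_eq [simp]: "- (x::'a) = x"
  using char_two[of x] by (simp add: neg_eq_iff_add_eq_0)

lemma diff_eq [simp]: "(x::'a) - y = x + y"
  by (metis diff_conv_add_uminus minus_eq)

lemma add_cancel2: "(x::'a) + (x + y) = y"
  by (simp add: char_two flip: add.assoc)

lemma frob_add2: "((x::'a) + y) ^ (2 ^ k) = x ^ (2 ^ k) + y ^ (2 ^ k)"
proof (induction k)
  case (Suc k)
  have sq: "(u + v)\<^sup>2 = u\<^sup>2 + v\<^sup>2" for u v :: 'a
    using char_two[of "u * v"] by (simp add: power2_eq_square algebra_simps add_cancel2)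
  have "(x + y) ^ 2 ^ Suc k = ((x + y) ^ 2 ^ k)\<^sup>2"
    by (simp add: mult.commute flip: power_mult)
  also have "\<dots> = (x ^ 2 ^ k)\<^sup>2 + (y ^ 2 ^ k)\<^sup>2" by (simp add: Suc sq)
  also have "\<dots> = x ^ 2 ^ Suc k + y ^ 2 ^ Suc k"
    by (simp add: mult.commute flip: power_mult)
  finally show ?case .
qed simp

lemma frob_add: "((x::'a) + y) ^ q = x ^ q + y ^ q"
  by (simp add: q_def frob_add2)

lemma q_pos: "q > 0"
  by (simp add: q_def)

lemma frob_zero [simp]: "(0::'a) ^ q = 0"
  using q_pos by simp

lemma pow_eq_self_iterate: "(x::'a) ^ (2 ^ k) = x \<Longrightarrow> x ^ (2 ^ (k * n)) = x"
  by (induction n) (simp_all add: power_add power_mult)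

text \<open>An element fixed by the \<open>i\<close>-fold and the \<open>m\<close>-fold iterate of
  squaring is fixed by squaring itself, because \<open>i\<close> and \<open>m\<close> are
  coprime.\<close>

lemma frob_fixed:
  assumes "(x::'a) ^ q = x" shows "x = 0 \<or> x = 1"
proof -
  have "x ^ (2 ^ i) = x" using assms by (simp add: q_def)
  show ?thesis
  proof (cases "i = 0")
    \<comment> \<open>\<open>bezout_nat\<close> asks for a nonzero first argument; here coprimality
      leaves only \<open>m = 1\<close>.\<close>
    case True
    then have "m = 1" using coprime_i_m by simp
    then have "x ^ 2 = x" using pow_card[of x] by simp
    then show ?thesis by (simp add: power2_eq_square)
  next
    case False
    then obtain k l where "i * k = m * l + 1"
      using bezout_nat[of i m] coprime_i_m by (auto simp: coprime_iff_gcd_eq_1)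
    then have "x = x ^ (2 ^ (m * l + 1))"
      using pow_eq_self_iterate[OF \<open>x ^ (2 ^ i) = x\<close>, of k] by simp
    also have "\<dots> = (x ^ (2 ^ (m * l)))\<^sup>2"
      by (simp add: power_add mult.commute flip: power_mult)
    also have "\<dots> = x\<^sup>2"
      by (simp only: pow_eq_self_iterate[OF pow_card])
    finally show ?thesis by (simp add: power2_eq_square)
  qed
qed

lemma of_nat_m: "of_nat m = (1::'a)"
proof -
  from odd_m obtain k where "m = 2 * k + 1" by (rule oddE)
  then show ?thesis by simp
qed

text \<open>If \<open>x ^ q = x + 1\<close>, then \<open>m\<close> applications of the Frobenius map
  send \<open>x\<close> to \<open>x + m = x + 1\<close>, yet together they raise to the power
  \<open>2 ^ (i * m)\<close>, which fixes \<open>x\<close>.\<close>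

lemma frob_shift_ne: "(x::'a) ^ q + x \<noteq> 1"
proof
  assume *: "x ^ q + x = 1"
  then have q: "x ^ q = x + 1" by (metis add.commute add_cancel2)
  have iter: "x ^ (2 ^ (i * n)) = x + of_nat n" for n
  proof (induction n)
    case (Suc n)
    have "x ^ 2 ^ (i * Suc n) = (x ^ 2 ^ (i * n)) ^ q"
      by (simp add: q_def power_add mult.commute flip: power_mult)
    also have "\<dots> = x ^ q + of_nat n ^ q" by (simp add: Suc frob_add)
    also have "(of_nat n :: 'a) ^ q = of_nat n"
    proof (induction n)
      case (Suc n)
      then show ?case using frob_add[of 1 "of_nat n"] by simp
    qed simp
    finally show ?case by (simp add: q algebra_simps)
  qed simp
  with iter[of m] of_nat_m pow_eq_self_iterate[OF pow_card, of x i] have "x = x + 1"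
    by (simp add: mult.commute)
  then show False by simp
qed

text \<open>Two nonzero elements with the same image under \<open>d \<mapsto> d ^ (q - 1)\<close>
  have a nonzero Frobenius fixed point as quotient, hence 1; finiteness turns this injectivity into
  surjectivity.\<close>

lemma frob_scale:
  assumes "c \<noteq> (0::'a)" shows "\<exists>d. d \<noteq> 0 \<and> d ^ q = d * c"
proof -
  let ?h = "\<lambda>d::'a. d ^ q / d"
  have "inj_on ?h (UNIV - {0})"
  proof (rule inj_onI)
    fix x y assume "x \<in> UNIV - {0}" "y \<in> UNIV - {0}" "?h x = ?h y"
    then have "(x / y) ^ q = x / y" "x / y \<noteq> 0" by (simp_all add: field_simps)
    then show "x = y" using frob_fixed[of "x / y"] by auto
  qed
  then have "?h ` (UNIV - {0}) = UNIV - {0}"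
    by (intro endo_inj_surj) auto
  moreover have "c \<in> UNIV - {0}" using assms by simp
  ultimately obtain d where "d \<noteq> 0" "?h d = c"
    by (metis (no_types, lifting) DiffE imageE singletonI)
  then show ?thesis using assms by (intro exI[of _ d]) (simp add: field_simps)
qed

section \<open>Traces and roots of linearized equations\<close>

definition trace :: "'a \<Rightarrow> 'a" where
  "trace x = (\<Sum>j<m. x ^ (2 ^ j))"

lemma trace_add: "trace (x + y) = trace x + trace y"
  by (simp add: trace_def frob_add2 sum.distrib)

lemma trace_one: "trace 1 = 1"
  using of_nat_m by (simp add: trace_def)

text \<open>Squaring shifts the summands of the trace cyclically, since
  \<open>y ^ (2 ^ m) = y\<close>.\<close>

lemma trace_frob2: "trace (x ^ (2 ^ k)) = trace x"
proof (induction k)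
  case (Suc k)
  have *: "trace (y ^ 2) = trace y" for y
  proof -
    have "trace (y ^ 2) + y = (\<Sum>j<Suc m. y ^ (2 ^ j))"
      by (simp add: trace_def sum.lessThan_Suc_shift power_mult add.commute
               del: sum.lessThan_Suc)
    also have "\<dots> = trace y + y" by (simp add: trace_def pow_card)
    finally show ?thesis by simp
  qed
  have "x ^ 2 ^ Suc k = (x ^ 2 ^ k) ^ 2" by (simp add: mult.commute flip: power_mult)
  then show ?case using * Suc by simp
qed simp

lemma trace_frob: "trace (x ^ q) = trace x"
  by (simp add: q_def trace_frob2)

text \<open>The root is \<open>T = t ^ (q - 1)\<close>: from \<open>t ^ q = t * T\<close> follows
  \<open>t ^ (q ^ 3) = t * T ^ (q\<^sup>2 + q + 1)\<close>, and then \<open>t\<close>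
  cancels.\<close>

lemma root_of_linearized:
  assumes "t \<noteq> (0::'a)" and t: "t = ((t ^ q) ^ q) ^ q + a * t ^ q"
  shows "a \<notin> Bset q"
proof -
  from q_pos obtain p where p: "q = Suc p" by (cases q) auto
  let ?T = "t ^ p"
  have tq: "t ^ q = t * ?T" by (simp add: p)
  have "((t ^ q) ^ q) ^ q = t * (?T * ?T ^ q * (?T ^ q) ^ q)"
    by (simp only: tq power_mult_distrib) (simp only: ac_simps)
  also have "?T * ?T ^ q * (?T ^ q) ^ q = ?T ^ (q\<^sup>2 + q + 1)"
    by (simp add: power2_eq_square power_add power_mult)
  finally have "t = t * ?T ^ (q\<^sup>2 + q + 1) + a * (t * ?T)" using t tq by simp
  moreover have "t * (?T ^ (q\<^sup>2 + q + 1) + a * ?T + 1)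
      = t * ?T ^ (q\<^sup>2 + q + 1) + a * (t * ?T) + t"
    by (simp only: distrib_left mult_1_right mult_1_left ac_simps)
  ultimately have "t * (?T ^ (q\<^sup>2 + q + 1) + a * ?T + 1) = 0"
    using char_two[of t] by metis
  then have "?T ^ (q\<^sup>2 + q + 1) + a * ?T + 1 = 0" using assms(1) by simp
  then show ?thesis using assms(1) by (auto simp: Bset_def intro!: exI[of _ "?T"])
qed

text \<open>
  The map \<open>t \<mapsto> t ^ q\<^sup>3 + a t ^ q + t\<close> is additive, so its kernel vanishes if and only if that of its
  adjoint for the trace form does; up to a power of the Frobenius map, the adjoint is
  \<open>t \<mapsto> t ^ q\<^sup>3 + a t ^ q\<^sup>2 + t\<close>.
\<close>

lemma root_of_adjoint_linearized:
  assumes "t \<noteq> (0::'a)" and t: "t = ((t ^ q) ^ q) ^ q + a * (t ^ q) ^ q"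
  shows "a \<notin> Bset q"
proof
  assume B: "a \<in> Bset q"
  let ?L = "\<lambda>x::'a. ((x ^ q) ^ q) ^ q + a * x ^ q + x"
  \<comment> \<open>Raised to the power \<open>q\<^sup>2\<close>, the equation for \<open>t\<close>
    says that the adjoint of \<open>?L\<close>, up to a Frobenius power, kills
    \<open>?y\<close>.\<close>
  let ?y = "(t ^ q) ^ q"
  have "inj ?L"
  proof (rule injI)
    fix x y assume eq: "?L x = ?L y"
    have "?L (x + y) = ?L x + ?L y" by (simp add: frob_add algebra_simps)
    then have "?L (x + y) = 0" using eq char_two by simp
    then have "x + y = ((((x + y) ^ q) ^ q) ^ q) + a * (x + y) ^ q"
      by (metis add_cancel2 add.commute add.right_neutral)
    then have "x + y = 0" using root_of_linearized[of "x + y" a] B by auto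
    then show "x = y" by (metis add_cancel2 add.right_neutral)
  qed
  then have "surj ?L" by (simp add: finite_UNIV_inj_surj)
  \<comment> \<open>Surjectivity provides \<open>x\<close> with \<open>?y * ?L x = 1\<close>, an
    element of trace 1 since \<open>m\<close> is odd.\<close>
  from surjD[OF this, of "1 / ?y"] obtain x where x: "1 / ?y = ?L x" by blast
  have y: "?y = ((?y ^ q) ^ q) ^ q + (a ^ q) ^ q * (?y ^ q) ^ q"
    using arg_cong[OF t, of "\<lambda>s. (s ^ q) ^ q"] by (simp add: frob_add power_mult_distrib)
  have "1 = trace (?y * ?L x)"
    by (simp only: x[symmetric]) (simp add: assms(1) trace_one)
  also have "\<dots> = trace (?y * ((x ^ q) ^ q) ^ q) + trace (?y * (a * x ^ q)) + trace (?y * x)"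
    by (simp add: trace_add distrib_left)
  \<comment> \<open>Frobenius powers bring every factor in \<open>x\<close> to
    \<open>x ^ (q ^ 3)\<close>, so that the cofactors add up to \<open>?y + ?y\<close>.\<close>
  also have "trace (?y * (a * x ^ q)) = trace (((?y * (a * x ^ q)) ^ q) ^ q)"
    by (simp add: trace_frob)
  also have "trace (?y * x) = trace ((((?y * x) ^ q) ^ q) ^ q)"
    by (simp add: trace_frob)
  also have "trace (?y * ((x ^ q) ^ q) ^ q) + trace (((?y * (a * x ^ q)) ^ q) ^ q)
      + trace ((((?y * x) ^ q) ^ q) ^ q)
    = trace ((?y + (((?y ^ q) ^ q) ^ q + (a ^ q) ^ q * (?y ^ q) ^ q)) * ((x ^ q) ^ q) ^ q)"
    by (simp add: power_mult_distrib algebra_simps flip: trace_add)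
  also have "\<dots> = trace 0"
    using char_two[of ?y] by (simp flip: y)
  finally show False by (simp add: trace_def power_0_left)
qed

end

section \<open>Semilinear maps without invariant subspaces\<close>

context binary_field
begin

lemma vec_char_two: "(u::'a \<times> 'a \<times> 'a) + u = 0"
  by (cases u) (simp add: zero_prod_def char_two)

lemma vec_add_cancel2: "(u::'a \<times> 'a \<times> 'a) + (u + v) = v"
  by (simp add: vec_char_two flip: add.assoc)

lemma vec_add_eq_0_iff: "(u::'a \<times> 'a \<times> 'a) + v = 0 \<longleftrightarrow> u = v"
  by (metis vec_add_cancel2 vec_char_two add.right_neutral)

definition frob3 :: "'a \<times> 'a \<times> 'a \<Rightarrow> 'a \<times> 'a \<times> 'a" where
  "frob3 = (\<lambda>(x, y, z). (x ^ q, y ^ q, z ^ q))"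

lemma frob3_scale: "frob3 (scale c u) = scale (c ^ q) (frob3 u)"
  by (auto simp: frob3_def scale_def power_mult_distrib split: prod.splits)

lemma frob3_cross: "frob3 (cross u v) = cross (frob3 u) (frob3 v)"
  by (auto simp: frob3_def cross_def frob_add power_mult_distrib split: prod.splits)

lemma frob3_eq_0 [simp]: "frob3 u = 0 \<longleftrightarrow> u = 0"
  using q_pos by (auto simp: frob3_def zero_prod_def split: prod.splits)

text \<open>
  A linear dependency among \<open>u\<close>, \<open>f u\<close>, \<open>f (f u)\<close> for \<open>f = K \<circ> frob3\<close> yields an invariant line or an
  invariant plane of \<open>f\<close>. The normal vector \<open>n\<close> of a plane is an eigenvector of the dual semilinear map,
  and eigenvectors rescale to fixed vectors because \<open>d \<mapsto> d ^ (q - 1)\<close> permutes the nonzero elements.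
\<close>

lemma independent_orbit:
  fixes K K' :: "'a \<times> 'a \<times> 'a \<Rightarrow> 'a \<times> 'a \<times> 'a"
  assumes K: "\<And>c v. K (scale c v) = scale c (K v)" "\<And>v. K v = 0 \<Longrightarrow> v = 0"
    and K': "\<And>c v. K' (scale c v) = scale c (K' v)" "\<And>v. K' v = 0 \<Longrightarrow> v = 0"
    and adj: "\<And>n v. dot (K' n) v = dot n (K v)"
    and fixed: "\<And>w. K (frob3 w) = w \<Longrightarrow> w = 0" "\<And>n. K' n = frob3 n \<Longrightarrow> n = 0"
    and "u \<noteq> 0"
  shows "dot (cross u (K (frob3 u))) (K (frob3 (K (frob3 u)))) \<noteq> 0"
proof
  define v where "v = K (frob3 u)"
  define n where "n = cross u v"
  assume "dot (cross u (K (frob3 u))) (K (frob3 (K (frob3 u)))) = 0"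
  then have plane: "dot n (K (frob3 u)) = 0" "dot n (K (frob3 v)) = 0"
    by (simp_all add: n_def v_def)
  have "v \<noteq> 0" using K(2)[of "frob3 u"] \<open>u \<noteq> 0\<close> by (auto simp: v_def)
  \<comment> \<open>If \<open>n = 0\<close>, the line of \<open>u\<close> is invariant;
    \<open>d\<close> is chosen so that \<open>scale d u\<close> is fixed.\<close>
  have "n \<noteq> 0"
  proof
    assume "n = 0"
    then obtain c where c: "u = scale c v"
      using cross_eq_0_imp_scale[of u v] \<open>v \<noteq> 0\<close> by (auto simp: n_def)
    then have "c \<noteq> 0" using \<open>u \<noteq> 0\<close> by auto
    then obtain d where d: "d \<noteq> 0" "d ^ q = d * c" using frob_scale by blast
    have "K (frob3 (scale d u)) = scale (d ^ q) v" by (simp add: frob3_scale K v_def)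
    also have "\<dots> = scale d u" by (simp add: c scale_scale d)
    finally show False using fixed(1) d(1) \<open>u \<noteq> 0\<close> by fastforce
  qed
  \<comment> \<open>Since \<open>frob3 n\<close> is the cross product of \<open>frob3 u\<close> and
    \<open>frob3 v\<close>, \<open>cross_cross\<close> expands this into multiples of those two,
    with coefficients that \<open>adj\<close> and \<open>plane\<close> make zero.\<close>
  have "cross (K' n) (frob3 n) = 0"
    by (simp add: n_def[THEN arg_cong[of _ _ frob3]] frob3_cross cross_cross adj plane)
  then obtain c where c: "K' n = scale c (frob3 n)"
    using cross_eq_0_imp_scale \<open>n \<noteq> 0\<close> frob3_eq_0 by blast
  then have "c \<noteq> 0" using \<open>n \<noteq> 0\<close> K'(2) by fastforce
  then obtain d where d: "d \<noteq> 0" "d ^ q = d * c" using frob_scale by blast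
  have "K' (scale d n) = frob3 (scale d n)" by (simp add: K' c scale_scale d frob3_scale)
  then show False using fixed(2) d(1) \<open>n \<noteq> 0\<close> by fastforce
qed

end

section \<open>Polarization, APN property and bijectivity\<close>

locale independent_semilinear = binary_field m i q ty
  for m i q and ty :: "'a::{field, finite} itself" +
  fixes f :: "'a \<times> 'a \<times> 'a \<Rightarrow> 'a \<times> 'a \<times> 'a"
  assumes f_add: "f (u + v) = f u + f v"
    and f_scale: "f (scale c u) = scale (c ^ q) (f u)"
    and independent: "u \<noteq> 0 \<Longrightarrow> dot (cross u (f u)) (f (f u)) \<noteq> 0"
begin

text \<open>Taking the dot product with \<open>u\<close> puts \<open>x\<close> into the span of \<open>u\<close> and \<open>f u\<close>.\<close>

lemma polarization_solution:
  assumes "u \<noteq> 0" and eq: "cross (f x) u + cross (f u) x = scale \<delta> (cross (f u) u)"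
  shows "\<exists>\<alpha>. x = scale \<alpha> u \<and> \<alpha> ^ q + \<alpha> = \<delta>"
proof -
  let ?v = "f u" let ?w = "f (f u)" let ?D = "dot (cross u ?v) ?w"
  have D: "?D \<noteq> 0" using independent assms(1) by blast
  have "dot u (cross (f u) x) = 0"
    using arg_cong[OF eq, of "dot u"] by (simp add: dot_add dot_scale)
  then have "scale ?D x = scale (dot (cross x ?v) ?w) u + scale (dot (cross u x) ?w) ?v"
    using cramer[of u ?v ?w x] by (simp add: dot_cross_rotate)
  then have "scale (inverse ?D) (scale ?D x)
      = scale (inverse ?D) (scale (dot (cross x ?v) ?w) u + scale (dot (cross u x) ?w) ?v)"
    by simp
  then obtain \<alpha> \<beta> where x: "x = scale \<alpha> u + scale \<beta> ?v"
    using D by (auto simp: scale_add scale_scale)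
  have fx: "f x = scale (\<alpha> ^ q) ?v + scale (\<beta> ^ q) ?w" by (simp add: x f_add f_scale)
  have "cross (f x) u + cross ?v x = scale (\<alpha> ^ q + \<alpha>) (cross ?v u) + scale (\<beta> ^ q) (cross ?w u)"
    by (simp only: fx) (simp add: x cross_add cross_scale scale_add algebra_simps)
  then have eq': "scale (\<alpha> ^ q + \<alpha>) (cross ?v u) + scale (\<beta> ^ q) (cross ?w u)
      = scale \<delta> (cross ?v u)"
    using eq by simp
  \<comment> \<open>Dotting with \<open>?v\<close> kills \<open>cross ?v u\<close> and isolates
    \<beta>; dotting with \<open>?w\<close> below kills \<open>cross ?w u\<close> and isolates
    \<alpha>.\<close>
  have "\<beta> ^ q * dot ?v (cross ?w u) = 0"
    using arg_cong[OF eq', of "dot ?v"] by (simp add: dot_add dot_scale)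
  moreover have "dot ?v (cross ?w u) = ?D"
    by (metis dot_cross_rotate dot_cross_cyclic)
  ultimately have "\<beta> = 0" using D by simp
  have nz: "dot ?w (cross ?v u) \<noteq> 0"
  proof -
    have "dot ?w (cross ?v u) = - ?D"
      by (simp add: dot_def cross_def algebra_simps split: prod.splits)
    then show ?thesis using D by simp
  qed
  have "(\<alpha> ^ q + \<alpha>) * dot ?w (cross ?v u) = \<delta> * dot ?w (cross ?v u)"
    using arg_cong[OF eq', of "dot ?w"] by (simp only: dot_add dot_scale) simp
  then have "\<alpha> ^ q + \<alpha> = \<delta>" using nz by simp
  with x \<open>\<beta> = 0\<close> show ?thesis by auto
qed

context
  fixes F L :: "'a \<times> 'a \<times> 'a \<Rightarrow> 'a \<times> 'a \<times> 'a"
  assumes F: "\<And>x. F x = L (cross (f x) x)"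
    and L_add: "\<And>u v. L (u + v) = L u + L v"
    and L_inj: "\<And>u. L u = 0 \<Longrightarrow> u = 0"
begin

text \<open>\<open>cross (f x) x\<close> appears twice and cancels. Inside \<open>L\<close>, what
  remains is additive in \<open>x\<close> up to a constant, so differences of solutions lie in the
  kernel of the polarization.\<close>

lemma F_polarization:
  "F (x + u) + F x = L (cross (f x) u + cross (f u) x + cross (f u) u)"
proof -
  have "cross (f (x + u)) (x + u) + cross (f x) x =
      cross (f x) x + (cross (f x) x + (cross (f x) u + cross (f u) x + cross (f u) u))"
    by (simp add: f_add cross_add algebra_simps)
  then show ?thesis by (simp only: F vec_add_cancel2 flip: L_add)
qed

lemma APN_cross: "APN F"
  unfolding APN_def
proof (intro allI impI)
  fix u b :: "'a \<times> 'a \<times> 'a"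
  assume "u \<noteq> 0"
  let ?S = "{x. F (x + u) + F x = b}"
  show "card ?S \<le> 2"
  proof (cases "?S = {}")
    case False
    then obtain x where x: "F (x + u) + F x = b" by blast
    have "?S \<subseteq> {x, x + u}"
    proof
      fix y assume "y \<in> ?S"
      with x have "(F (x + u) + F x) + (F (y + u) + F y) = 0" by (simp add: vec_char_two)
      then have "L ((cross (f x) u + cross (f u) x + cross (f u) u)
          + (cross (f y) u + cross (f u) y + cross (f u) u)) = 0"
        by (simp only: F_polarization L_add)
      then have "(cross (f x) u + cross (f u) x + cross (f u) u)
          + (cross (f y) u + cross (f u) y + cross (f u) u) = 0" by (rule L_inj)
      then have "cross (f (x + y)) u + cross (f u) (x + y) = scale 0 (cross (f u) u)"
        by (simp add: f_add cross_add vec_add_eq_0_iff algebra_simps)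
      then obtain \<alpha> where \<alpha>: "x + y = scale \<alpha> u" "\<alpha> ^ q + \<alpha> = 0"
        using polarization_solution \<open>u \<noteq> 0\<close> by blast
      then have "\<alpha> ^ q = \<alpha>" by (metis add_cancel2 add.commute add.right_neutral)
      then have "\<alpha> = 0 \<or> \<alpha> = 1" by (rule frob_fixed)
      moreover have "y = x + scale \<alpha> u" by (metis \<alpha>(1) vec_add_cancel2)
      ultimately show "y \<in> {x, x + u}" by auto
    qed
    then have "card ?S \<le> card {x, x + u}" by (intro card_mono) auto
    also have "\<dots> \<le> 2" by (simp add: card_insert_if)
    finally show ?thesis .
  qed (simp only: card.empty)
qed

lemma bij_cross: "bij F"
proof -
  have "inj F"
  proof (rule injI, rule ccontr)
    fix x y assume eq: "F x = F y" and "x \<noteq> y"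
    define u where "u = x + y"
    have "u \<noteq> 0" "y = x + u"
      using \<open>x \<noteq> y\<close> by (simp_all add: u_def vec_add_eq_0_iff vec_add_cancel2)
    then have "F (x + u) + F x = 0" using eq by (simp add: vec_char_two)
    then have "cross (f x) u + cross (f u) x + cross (f u) u = 0"
      unfolding F_polarization by (rule L_inj)
    then have "cross (f x) u + cross (f u) x = scale 1 (cross (f u) u)"
      by (simp add: vec_add_eq_0_iff)
    then show False
      using polarization_solution[OF \<open>u \<noteq> 0\<close>] frob_shift_ne by blast
  qed
  then show ?thesis by (simp add: bij_def finite_UNIV_inj_surj)
qed

end

end

section \<open>The families\<close>

context binary_field
begin

lemma Gmap_APN_bij:
  assumes "a \<in> Bset q" shows "APN (Gmap q (a::'a))" "bij (Gmap q a)"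
proof -
  define K :: "'a \<times> 'a \<times> 'a \<Rightarrow> 'a \<times> 'a \<times> 'a" where "K = (\<lambda>(x, y, z). (a * y + z, x, y))"
  \<comment> \<open>The transpose of \<open>K\<close>, acting on normal vectors of planes.\<close>
  define K' :: "'a \<times> 'a \<times> 'a \<Rightarrow> 'a \<times> 'a \<times> 'a" where "K' = (\<lambda>(x, y, z). (y, a * x + z, x))"
  \<comment> \<open>The \<open>a\<close>-multiple of the first component cancels the
    \<open>a * y ^ (q + 1)\<close> in the third component of the cross product and supplies
    \<open>a * x ^ q * z\<close>.\<close>
  define L :: "'a \<times> 'a \<times> 'a \<Rightarrow> 'a \<times> 'a \<times> 'a" where "L = (\<lambda>(x, y, z). (z + a * x, x, y))"
  have K_scale: "K (scale c v) = scale c (K v)" for c v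
    by (cases v rule: prod_cases3; simp add: K_def scale_def algebra_simps)
  have orbit: "u \<noteq> 0 \<Longrightarrow> dot (cross u (K (frob3 u))) (K (frob3 (K (frob3 u)))) \<noteq> 0" for u
  proof (rule independent_orbit[where K' = K'])
    show "K' (scale c v) = scale c (K' v)" for c v
      by (cases v rule: prod_cases3; simp add: K'_def scale_def algebra_simps)
    show "K v = 0 \<Longrightarrow> v = 0" "K' v = 0 \<Longrightarrow> v = 0" for v
      by (cases v rule: prod_cases3; auto simp: K_def K'_def zero_prod_def)+
    show "dot (K' n) v = dot n (K v)" for n v
      by (cases v rule: prod_cases3; cases n rule: prod_cases3;
          simp add: K_def K'_def dot_def algebra_simps)
    show "w = 0" if w: "K (frob3 w) = w" for w
    proof -
      obtain x y z where xyz: "w = (x, y, z)" by (rule prod_cases3)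
      then have eqs: "x = a * y ^ q + z ^ q" "y = x ^ q" "z = y ^ q"
        using w by (auto simp: K_def frob3_def)
      \<comment> \<open>Elimination of \<open>y\<close> and \<open>z\<close>: an invariant line
        leads to the adjoint equation, an invariant plane, treated below, to the direct one.\<close>
      then have "x = ((x ^ q) ^ q) ^ q + a * (x ^ q) ^ q" by (simp add: add.commute)
      then have x: "x = 0" using root_of_adjoint_linearized assms by blast
      have y: "y = 0" by (simp only: eqs(2) x frob_zero)
      have z: "z = 0" by (simp only: eqs(3) y frob_zero)
      show ?thesis by (simp only: xyz x y z zero_prod_def)
    qed
    show "n = 0" if n: "K' n = frob3 n" for n
    proof -
      obtain x y z where xyz: "n = (x, y, z)" by (rule prod_cases3)
      then have eqs: "y = x ^ q" "a * x + z = y ^ q" "x = z ^ q"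
        using n by (auto simp: K'_def frob3_def)
      then have "z = ((z ^ q) ^ q) ^ q + a * z ^ q" by (metis add_cancel2 add.commute)
      then have z: "z = 0" using root_of_linearized assms by blast
      have x: "x = 0" by (simp only: eqs(3) z frob_zero)
      have y: "y = 0" by (simp only: eqs(1) x frob_zero)
      show ?thesis by (simp only: xyz x y z zero_prod_def)
    qed
  qed (simp add: K_scale)
  interpret independent_semilinear m i q ty "\<lambda>u. K (frob3 u)"
  proof unfold_locales
    show "K (frob3 (u + v)) = K (frob3 u) + K (frob3 v)" for u v
      by (cases u rule: prod_cases3; cases v rule: prod_cases3;
          simp add: frob3_def K_def frob_add algebra_simps)
  qed (simp_all only: frob3_scale K_scale orbit not_False_eq_True)
  have F: "Gmap q a v = L (cross (K (frob3 v)) v)" for v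
    by (cases v rule: prod_cases3)
      (simp add: Gmap_def L_def K_def frob3_def cross_def algebra_simps add_cancel2 char_two)
  have L: "L (u + v) = L u + L v" "L u = 0 \<Longrightarrow> u = 0" for u v
    by (cases u rule: prod_cases3; cases v rule: prod_cases3;
        auto simp: L_def zero_prod_def algebra_simps)+
  show "APN (Gmap q a)" "bij (Gmap q a)"
    using APN_cross[of "Gmap q a" L] bij_cross[of "Gmap q a" L] F L by blast+
qed

text \<open>Compared with \<open>Gmap\<close>, lines and planes exchange their linearized equations,
  and the cross product already has the components of \<open>Hmap\<close>, in reverse order.\<close>

lemma Hmap_APN_bij:
  assumes "a \<in> Bset q" shows "APN (Hmap q (a::'a))" "bij (Hmap q a)"
proof -
  define K :: "'a \<times> 'a \<times> 'a \<Rightarrow> 'a \<times> 'a \<times> 'a" where "K = (\<lambda>(x, y, z). (z, x + a * y, y))"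
  define K' :: "'a \<times> 'a \<times> 'a \<Rightarrow> 'a \<times> 'a \<times> 'a" where "K' = (\<lambda>(x, y, z). (y, a * y + z, x))"
  define L :: "'a \<times> 'a \<times> 'a \<Rightarrow> 'a \<times> 'a \<times> 'a" where "L = (\<lambda>(x, y, z). (z, y, x))"
  have K_scale: "K (scale c v) = scale c (K v)" for c v
    by (cases v rule: prod_cases3; simp add: K_def scale_def algebra_simps)
  have orbit: "u \<noteq> 0 \<Longrightarrow> dot (cross u (K (frob3 u))) (K (frob3 (K (frob3 u)))) \<noteq> 0" for u
  proof (rule independent_orbit[where K' = K'])
    show "K' (scale c v) = scale c (K' v)" for c v
      by (cases v rule: prod_cases3; simp add: K'_def scale_def algebra_simps)
    show "K v = 0 \<Longrightarrow> v = 0" "K' v = 0 \<Longrightarrow> v = 0" for v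
      by (cases v rule: prod_cases3; auto simp: K_def K'_def zero_prod_def)+
    show "dot (K' n) v = dot n (K v)" for n v
      by (cases v rule: prod_cases3; cases n rule: prod_cases3;
          simp add: K_def K'_def dot_def algebra_simps)
    show "w = 0" if w: "K (frob3 w) = w" for w
    proof -
      obtain x y z where xyz: "w = (x, y, z)" by (rule prod_cases3)
      then have eqs: "x = z ^ q" "y = x ^ q + a * y ^ q" "z = y ^ q"
        using w by (auto simp: K_def frob3_def)
      then have "y = ((y ^ q) ^ q) ^ q + a * y ^ q" by metis
      then have y: "y = 0" using root_of_linearized assms by blast
      have z: "z = 0" by (simp only: eqs(3) y frob_zero)
      have x: "x = 0" by (simp only: eqs(1) z frob_zero)
      show ?thesis by (simp only: xyz x y z zero_prod_def)
    qed
    show "n = 0" if n: "K' n = frob3 n" for n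
    proof -
      obtain x y z where xyz: "n = (x, y, z)" by (rule prod_cases3)
      then have eqs: "y = x ^ q" "a * y + z = y ^ q" "x = z ^ q"
        using n by (auto simp: K'_def frob3_def)
      then have "z = ((z ^ q) ^ q) ^ q + a * (z ^ q) ^ q" by (metis add_cancel2 add.commute)
      then have z: "z = 0" using root_of_adjoint_linearized assms by blast
      have x: "x = 0" by (simp only: eqs(3) z frob_zero)
      have y: "y = 0" by (simp only: eqs(1) x frob_zero)
      show ?thesis by (simp only: xyz x y z zero_prod_def)
    qed
  qed (simp add: K_scale)
  interpret independent_semilinear m i q ty "\<lambda>u. K (frob3 u)"
  proof unfold_locales
    show "K (frob3 (u + v)) = K (frob3 u) + K (frob3 v)" for u v
      by (cases u rule: prod_cases3; cases v rule: prod_cases3;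
          simp add: frob3_def K_def frob_add algebra_simps)
  qed (simp_all only: frob3_scale K_scale orbit not_False_eq_True)
  have F: "Hmap q a v = L (cross (K (frob3 v)) v)" for v
    by (cases v rule: prod_cases3)
      (simp add: Hmap_def L_def K_def frob3_def cross_def algebra_simps)
  have L: "L (u + v) = L u + L v" "L u = 0 \<Longrightarrow> u = 0" for u v
    by (cases u rule: prod_cases3; cases v rule: prod_cases3;
        auto simp: L_def zero_prod_def)+
  show "APN (Hmap q a)" "bij (Hmap q a)"
    using APN_cross[of "Hmap q a" L] bij_cross[of "Hmap q a" L] F L by blast+
qed

end

section \<open>Diagonal equivalence by comparing coefficients\<close>

lemma diag_equiv_iff:
  fixes F F' :: "'a::field \<times> 'a \<times> 'a \<Rightarrow> 'a \<times> 'a \<times> 'a"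
  shows
  "diag_equiv F F' \<longleftrightarrow>
     (\<exists>k1 k2 k3 l1 l2 l3. k1 \<noteq> 0 \<and> k2 \<noteq> 0 \<and> k3 \<noteq> 0 \<and> l1 \<noteq> 0 \<and> l2 \<noteq> 0 \<and> l3 \<noteq> 0 \<and>
       (\<forall>x y z. F' (x, y, z) =
          (case F (l1 * x, l2 * y, l3 * z) of (u, v, w) \<Rightarrow> (k1 * u, k2 * v, k3 * w))))"
proof -
  define D :: "'a \<Rightarrow> 'a \<Rightarrow> 'a \<Rightarrow> 'a \<times> 'a \<times> 'a \<Rightarrow> 'a \<times> 'a \<times> 'a" where
    "D = (\<lambda>l1 l2 l3 (x, y, z). (l1 * x, l2 * y, l3 * z))"
  have pointwise: "(\<forall>x y z. F' (x, y, z) =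
        (case F (l1 * x, l2 * y, l3 * z) of (u, v, w) \<Rightarrow> (k1 * u, k2 * v, k3 * w)))
      \<longleftrightarrow> F' = D k1 k2 k3 \<circ> F \<circ> D l1 l2 l3" for k1 k2 k3 l1 l2 l3
    by (auto simp: fun_eq_iff D_def)
  have "diag_equiv F F' \<longleftrightarrow> (\<exists>A\<^sub>1 A\<^sub>2.
      (\<exists>k1 k2 k3. k1 \<noteq> 0 \<and> k2 \<noteq> 0 \<and> k3 \<noteq> 0 \<and> A\<^sub>1 = D k1 k2 k3) \<and>
      (\<exists>l1 l2 l3. l1 \<noteq> 0 \<and> l2 \<noteq> 0 \<and> l3 \<noteq> 0 \<and> A\<^sub>2 = D l1 l2 l3) \<and> F' = A\<^sub>1 \<circ> F \<circ> A\<^sub>2)"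
    by (simp only: diag_equiv_def diagonal_bijection_def D_def)
  also have "\<dots> \<longleftrightarrow> (\<exists>k1 k2 k3 l1 l2 l3. k1 \<noteq> 0 \<and> k2 \<noteq> 0 \<and> k3 \<noteq> 0 \<and> l1 \<noteq> 0 \<and> l2 \<noteq> 0 \<and> l3 \<noteq> 0 \<and>
      F' = D k1 k2 k3 \<circ> F \<circ> D l1 l2 l3)" (is "?L \<longleftrightarrow> ?R")
  proof
    assume ?L
    then show ?R by (elim exE conjE) (intro exI conjI; (assumption | simp only:))
  next
    assume ?R
    then show ?L by (elim exE conjE) (intro exI conjI; (assumption | rule refl))
  qed
  finally show ?thesis by (simp only: pointwise)
qed

text \<open>Diagonal maps multiply each monomial by a scalar. The coefficient equations express
  \<open>l1\<close> and \<open>l2\<close> through \<open>l3\<close> and leave one condition on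
  \<open>a\<close>.\<close>

lemma Gmap_diag_equiv_iff:
  fixes a :: "'a::field"
  assumes "q > 0" "a \<noteq> 0"
  shows "diag_equiv (Gmap q a) (Gmap q 1) \<longleftrightarrow> a ^ (q\<^sup>2 + q + 1) = 1"
proof
  assume "diag_equiv (Gmap q a) (Gmap q 1)"
  then obtain k1 k2 k3 l1 l2 l3 where nz: "l1 \<noteq> 0" "l2 \<noteq> 0" "l3 \<noteq> 0"
    and eq: "\<And>x y z. Gmap q 1 (x, y, z) =
      (case Gmap q a (l1 * x, l2 * y, l3 * z) of (u, v, w) \<Rightarrow> (k1 * u, k2 * v, k3 * w))"
    unfolding diag_equiv_iff by blast
  \<comment> \<open>Unit vectors give the monomials in one variable, sums of two of them the mixed
    ones.\<close>
  have k1: "k1 * l1 ^ (q + 1) = 1" "k1 * (a * l1 ^ q * l3) = 1" "k1 * (l2 * l3 ^ q) = 1"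
    and k2: "k2 * (l1 ^ q * l3) = 1" "k2 * l2 ^ (q + 1) = 1"
    and k3: "k3 * (l1 * l2 ^ q) = 1" "k3 * l3 ^ (q + 1) = 1"
    using eq[of 1 0 0] eq[of 0 1 0] eq[of 0 0 1] eq[of 1 0 1] eq[of 0 1 1] eq[of 1 1 0] assms(1)
    by (simp_all add: Gmap_def power_0_left distrib_left)
  have "k1 \<noteq> 0" "k3 \<noteq> 0" using k1 k3 by auto
  have l1: "l1 = a * l3"
    using k1(1,2) \<open>k1 \<noteq> 0\<close> nz
    by (metis mult.assoc mult.commute mult_left_cancel power_add power_one_right power_not_zero)
  have l2: "l2 = a ^ (q + 1) * l3"
  proof -
    have "l2 * l3 ^ q = l1 ^ (q + 1)" using k1(1,3) \<open>k1 \<noteq> 0\<close> by (metis mult_left_cancel)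
    then have "l2 * l3 ^ q = (a ^ (q + 1) * l3) * l3 ^ q"
      by (simp add: l1 power_mult_distrib ac_simps)
    then show ?thesis using nz by simp
  qed
  have "l1 * l2 ^ q = l3 ^ (q + 1)" using k3 \<open>k3 \<noteq> 0\<close> by (metis mult_left_cancel)
  then have "a ^ (q\<^sup>2 + q + 1) * l3 ^ (q + 1) = 1 * l3 ^ (q + 1)"
    by (simp add: l1 l2 power_mult_distrib power2_eq_square power_add power_mult ac_simps)
  then show "a ^ (q\<^sup>2 + q + 1) = 1" using nz by simp
next
  assume *: "a ^ (q\<^sup>2 + q + 1) = 1"
  \<comment> \<open>The condition on \<open>a\<close> becomes \<open>a * p * r = 1\<close>. Solving
    the coefficient equations with \<open>l3 = 1\<close> gives \<open>l1 = a\<close>,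
    \<open>l2 = a * p\<close>, \<open>k1 = r\<close>, \<open>k2 = a * r\<close>,
    \<open>k3 = 1\<close>.\<close>
  define p r where "p = a ^ q" and "r = p ^ q"
  have apr: "a * p * r = 1"
    using * by (simp add: p_def r_def power2_eq_square power_add power_mult ac_simps)
  then have nz: "p \<noteq> 0" "r \<noteq> 0" by auto
  \<comment> \<open>With the \<open>q\<close>-th powers as separate variables, these are polynomial
    identities modulo \<open>a * p * r = 1\<close>.\<close>
  have comp:
    "u * x + u * z + y * w = r * ((a * x) * (p * u) + a * (p * u) * z + (a * p * y) * w)"
    "u * z + v * y = a * r * ((p * u) * z + (a * p * y) * (p * r * v))"
    "x * v + v * z + w * z = a * x * (p * r * v) + a * (p * r * v) * z + w * z"
    for x y z u v w
    using apr by Groebner_Basis.algebra+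
  show "diag_equiv (Gmap q a) (Gmap q 1)"
    unfolding diag_equiv_iff
  proof (intro exI conjI allI)
    fix x y z
    have "(a * p * y) ^ q = p * r * y ^ q" "(a * x) ^ q = p * x ^ q"
      by (simp_all add: power_mult_distrib p_def r_def)
    with comp(1)[of "x ^ q" x z y "z ^ q"] comp(2)[of "x ^ q" z "y ^ q" y]
      comp(3)[of x "y ^ q" z "z ^ q"]
    show "Gmap q 1 (x, y, z) = (case Gmap q a (a * x, a * p * y, 1 * z) of
      (u, v, w) \<Rightarrow> (r * u, a * r * v, 1 * w))"
      by (simp add: Gmap_def ac_simps)
  qed (use nz assms in auto)
qed

lemma Hmap_diag_equiv_iff:
  fixes a :: "'a::field"
  assumes "q > 0" "a \<noteq> 0"
  shows "diag_equiv (Hmap q a) (Hmap q 1) \<longleftrightarrow> a ^ (q\<^sup>2 + q + 1) = 1"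
proof
  assume "diag_equiv (Hmap q a) (Hmap q 1)"
  then obtain k1 k2 k3 l1 l2 l3 where nz: "l1 \<noteq> 0" "l2 \<noteq> 0" "l3 \<noteq> 0"
    and eq: "\<And>x y z. Hmap q 1 (x, y, z) =
      (case Hmap q a (l1 * x, l2 * y, l3 * z) of (u, v, w) \<Rightarrow> (k1 * u, k2 * v, k3 * w))"
    unfolding diag_equiv_iff by blast
  have k1: "k1 * l1 ^ (q + 1) = 1" "k1 * (l2 * l3 ^ q) = 1"
    and k3: "k3 * (l1 ^ q * l3) = 1" "k3 * l2 ^ (q + 1) = 1" "k3 * (a * l2 ^ q * l3) = 1"
    using eq[of 1 0 0] eq[of 0 1 0] eq[of 0 0 1] eq[of 1 0 1] eq[of 0 1 1] eq[of 1 1 0] assms(1)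
    by (simp_all add: Hmap_def power_0_left distrib_left)
  have "k1 \<noteq> 0" "k3 \<noteq> 0" using k1 k3 by auto
  have l2: "l2 = a * l3"
    using k3(2,3) \<open>k3 \<noteq> 0\<close> nz
    by (metis mult.assoc mult.commute mult_left_cancel power_add power_one_right power_not_zero)
  have "l1 ^ q * l3 = l2 ^ (q + 1)" using k3(1,2) \<open>k3 \<noteq> 0\<close> by (metis mult_left_cancel)
  then have "l1 ^ q * l3 = (a ^ (q + 1) * l3 ^ q) * l3"
    by (simp add: l2 power_mult_distrib ac_simps)
  then have l1q: "l1 ^ q = a ^ (q + 1) * l3 ^ q" using nz by simp
  have "l1 ^ (q + 1) = l2 * l3 ^ q" using k1 \<open>k1 \<noteq> 0\<close> by (metis mult_left_cancel)
  \<comment> \<open>So far \<open>l1\<close> is known only through \<open>l1 ^ q\<close>; comparison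
    with \<open>l1 ^ (q + 1)\<close> isolates \<open>l1\<close> itself.\<close>
  then have "(a ^ q * l1) * (a * l3 ^ q) = l3 * (a * l3 ^ q)"
    using l1q by (simp add: l2 ac_simps)
  then have "a ^ q * l1 = l3" using nz assms by simp
  then have "(a ^ q) ^ q * l1 ^ q = l3 ^ q" by (metis power_mult_distrib)
  then have "a ^ (q\<^sup>2 + q + 1) * l3 ^ q = 1 * l3 ^ q"
    by (simp add: l1q power2_eq_square power_add power_mult ac_simps)
  then show "a ^ (q\<^sup>2 + q + 1) = 1" using nz by simp
next
  assume *: "a ^ (q\<^sup>2 + q + 1) = 1"
  \<comment> \<open>With \<open>l3 = 1\<close> the equations above yield \<open>l2 = a\<close> and
    \<open>l1 = 1 / p = a * r\<close>.\<close>
  define p r where "p = a ^ q" and "r = p ^ q"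
  have apr: "a * p * r = 1"
    using * by (simp add: p_def r_def power2_eq_square power_add power_mult ac_simps)
  then have nz: "p \<noteq> 0" "r \<noteq> 0" by auto
  have comp:
    "u * x + x * v + y * w = p * r * ((a * p * u) * (a * r * x) + a * (a * r * x) * (p * v) + a * y * w)"
    "x * v + w * z = a * r * x * (p * v) + w * z"
    "u * z + v * y + v * z = r * (a * p * u * z + (p * v) * (a * y) + a * (p * v) * z)"
    for x y z u v w
    using apr by Groebner_Basis.algebra+
  show "diag_equiv (Hmap q a) (Hmap q 1)"
    unfolding diag_equiv_iff
  proof (intro exI conjI allI)
    fix x y z
    \<comment> \<open>Raising \<open>a * p * r = 1\<close> to the power \<open>q\<close> amounts to
      \<open>r ^ q = a\<close>, which evaluates \<open>(a * r) ^ q\<close>.\<close>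
    have "p * r * r ^ q = (a * p * r) ^ q"
      by (simp only: power_mult_distrib p_def[symmetric] r_def[symmetric])
    then have "p * r * r ^ q = a * p * r" by (simp only: apr power_one)
    then have "r * (a * r) ^ q = r * (a * p)"
      by (simp add: power_mult_distrib ac_simps flip: p_def)
    then have "(a * r * x) ^ q = a * p * x ^ q" "(a * y) ^ q = p * y ^ q"
      using nz by (simp_all add: power_mult_distrib p_def)
    with comp(1)[of "x ^ q" x "y ^ q" y "z ^ q"] comp(2)[of x "y ^ q" "z ^ q" z]
      comp(3)[of "x ^ q" z "y ^ q" y]
    show "Hmap q 1 (x, y, z) = (case Hmap q a (a * r * x, a * y, 1 * z) of
      (u, v, w) \<Rightarrow> (p * r * u, 1 * v, r * w))"
      by (simp add: Hmap_def ac_simps)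
  qed (use nz assms in auto)
qed

section \<open>Counting\<close>

text \<open>Write the group order as \<open>g * k\<close>. The power \<open>k\<close> maps the
  nonzero elements into the \<open>g\<close>-th roots of unity with fibres of at most
  \<open>k\<close> elements, so there are at least \<open>g\<close> roots; the degree of the
  polynomial allows no more.\<close>

lemma card_roots_of_unity:
  assumes "g dvd CARD('a::{field, finite}) - 1"
  shows "card {x::'a. x ^ g = 1} = g"
proof -
  let ?n = "CARD('a) - 1" and ?U = "UNIV - {0::'a}"
  have "CARD('a) > 1" using card_mono[of UNIV "{0, 1::'a}"] by simp
  then have n: "?n > 0" by simp
  obtain k where k: "?n = g * k" using assms by (rule dvdE)
  have pos: "g > 0" "k > 0" using n unfolding k by simp_all
  have roots_le: "card {x::'a. x ^ d = c} \<le> d" if "d > 0" for d c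
  proof -
    let ?p = "monom 1 d - [:c:]"
    have "coeff ?p d = 1" using that by (simp add: coeff_pCons split: nat.splits)
    then have "?p \<noteq> 0" by (metis coeff_0 zero_neq_one)
    moreover have "{x. poly ?p x = 0} = {x. x ^ d = c}" by (simp add: poly_monom)
    moreover have "degree ?p \<le> d" by (intro degree_diff_le) (simp_all add: degree_monom_le)
    ultimately show ?thesis using card_poly_roots_bound[of ?p] by simp
  qed
  have unit: "(x ^ k) ^ g = 1" if "x \<noteq> 0" for x :: 'a
  proof -
    have "x ^ (g * k) = 1" using pow_card_minus_one[OF that] by (simp only: k)
    then show ?thesis by (simp add: mult.commute flip: power_mult)
  qed
  have "?n = card (\<Union>y \<in> {y::'a. y ^ g = 1}. {x. x ^ k = y})"
  proof -
    have "(\<Union>y \<in> {y::'a. y ^ g = 1}. {x. x ^ k = y}) = ?U"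
      using unit pos by (auto simp: power_0_left)
    then show ?thesis by (simp add: card_Diff_singleton)
  qed
  also have "\<dots> \<le> (\<Sum>y \<in> {y::'a. y ^ g = 1}. card {x. x ^ k = y})"
    by (intro card_UN_le) simp
  also have "\<dots> \<le> card {y::'a. y ^ g = 1} * k"
    using sum_bounded_above[of "{y::'a. y ^ g = 1}" "\<lambda>y. card {x. x ^ k = y}" k] roots_le pos by simp
  finally have "g * k \<le> card {y::'a. y ^ g = 1} * k" by (simp only: k)
  then have "g \<le> card {y::'a. y ^ g = 1}" using pos by simp
  with roots_le[of g 1] pos show ?thesis by simp
qed

text \<open>Nonzero elements satisfy \<open>x ^ (2 ^ m - 1) = 1\<close>, so a Bezout identity
  replaces \<open>N\<close> by its gcd with the group order, a divisor of that order.\<close>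

lemma (in binary_field) card_pow_eq_one:
  "card {a::'a. a \<noteq> 0 \<and> a ^ N = 1} = gcd N (2 ^ m - 1)"
proof -
  define g where "g = gcd N (2 ^ m - 1)"
  have "m > 0" using odd_m by (cases m) auto
  have "x ^ g = 1" if "x \<noteq> 0" "x ^ N = 1" for x :: 'a
  proof (cases "N = 0")
    case True
    then show ?thesis using pow_card_minus_one[of x] that by (simp add: g_def card)
  next
    case False
    then obtain k l where kl: "N * k = (2 ^ m - 1) * l + g"
      using bezout_nat unfolding g_def by blast
    have "x ^ (2 ^ m - 1) = 1" using pow_card_minus_one[OF that(1)] by (simp only: card)
    then have "x ^ (N * k) = 1" "x ^ ((2 ^ m - 1) * l) = 1"
      by (simp_all only: power_mult power_one that(2))
    then show ?thesis using kl by (simp add: power_add)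
  qed
  moreover have "x ^ N = 1" if "x ^ g = 1" for x :: 'a
    using that unfolding g_def by (metis dvdE gcd_dvd1 power_mult power_one)
  moreover have "x \<noteq> 0" if "x ^ g = 1" for x :: 'a
    using that one_less_power[of "2::nat" m] \<open>m > 0\<close>
    by (auto simp: g_def power_0_left split: if_splits)
  ultimately have "{a::'a. a \<noteq> 0 \<and> a ^ N = 1} = {a. a ^ gcd N (2 ^ m - 1) = 1}"
    unfolding g_def by blast
  then show ?thesis
    using card_roots_of_unity[where 'a = 'a, of "gcd N (2 ^ m - 1)"] by (simp add: card)
qed

lemma subgroup_pow_eq_one:
  "subgroup {a::'a::field. a \<noteq> 0 \<and> a ^ N = 1} (mult_of (ring_of_type_algebra :: 'a ring))"
proof -
  let ?R = "ring_of_type_algebra :: 'a ring"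
  interpret field ?R by rule
  interpret group "mult_of ?R"
    \<comment> \<open>\<open>field_mult_group\<close> is stated for another constant of the same name and definition.\<close>
    using field_mult_group
    by (simp add: Ring_Divisibility.mult_of_def Multiplicative_Group.mult_of_def)
  have R: "carrier ?R = UNIV" "monoid.mult ?R = (*)" "one ?R = 1" "zero ?R = 0"
    by (simp_all add: ring_of_type_algebra_def)
  have inv: "m_inv (mult_of ?R) x = inverse x" if "x \<noteq> 0" for x
    using that by (intro inv_equality) (simp_all add: R)
  show ?thesis
    by (intro subgroupI) (auto simp: R inv power_mult_distrib power_inverse intro: exI[of _ 1])
qed

theorem theorem4p2:
  fixes m i q :: nat
  assumes "CARD('a::{field, finite}) = 2 ^ m"
    and "m \<ge> 3" and "odd m"
    and "q = 2 ^ i" and "gcd i m = 1"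
  shows
    "(\<forall>a::'a. a \<noteq> 0 \<longrightarrow>
        (diag_equiv (Gmap q a) (Gmap q 1) \<longleftrightarrow> diag_equiv (Hmap q a) (Hmap q 1)) \<and>
        (diag_equiv (Hmap q a) (Hmap q 1) \<longleftrightarrow> a ^ (q\<^sup>2 + q + 1) = 1)) \<and>
     (let d\<^sub>0 = gcd (q\<^sup>2 + q + 1) (2 ^ m - 1);
          S = {a::'a. a \<noteq> 0 \<and> a ^ (q\<^sup>2 + q + 1) = 1}
      in {a::'a. a \<noteq> 0 \<and>
            (diag_equiv (Gmap q a) (Gmap q 1) \<or> diag_equiv (Hmap q a) (Hmap q 1))} = S \<and>
         subgroup S (mult_of (ring_of_type_algebra :: 'a ring)) \<and>
         card S = d\<^sub>0 \<and>
         (card (Bset q :: 'a set) > d\<^sub>0 \<longrightarrow>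
           (\<exists>a \<in> (Bset q :: 'a set).
              APN (Gmap q a) \<and> bij (Gmap q a) \<and> APN (Hmap q a) \<and> bij (Hmap q a) \<and>
              \<not> diag_equiv (Gmap q a) (Gmap q 1) \<and> \<not> diag_equiv (Hmap q a) (Hmap q 1))))"
proof -
  interpret binary_field m i q "TYPE('a)"
    using assms by unfold_locales (simp_all add: coprime_iff_gcd_eq_1)
  let ?S = "{a::'a. a \<noteq> 0 \<and> a ^ (q\<^sup>2 + q + 1) = 1}"
  have diag: "diag_equiv (Gmap q a) (Gmap q 1) \<longleftrightarrow> a ^ (q\<^sup>2 + q + 1) = 1"
    "diag_equiv (Hmap q a) (Hmap q 1) \<longleftrightarrow> a ^ (q\<^sup>2 + q + 1) = 1" if "a \<noteq> 0" for a :: 'a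
    using Gmap_diag_equiv_iff Hmap_diag_equiv_iff q_pos that by blast+
  have "\<exists>a\<in>(Bset q :: 'a set). APN (Gmap q a) \<and> bij (Gmap q a) \<and> APN (Hmap q a) \<and> bij (Hmap q a) \<and>
      \<not> diag_equiv (Gmap q a) (Gmap q 1) \<and> \<not> diag_equiv (Hmap q a) (Hmap q 1)"
    if "card (Bset q :: 'a set) > gcd (q\<^sup>2 + q + 1) (2 ^ m - 1)"
  proof -
    \<comment> \<open>The size of \<open>?S\<close> is exactly the gcd, so a larger
      \<open>Bset q\<close> has an element outside it.\<close>
    have "\<not> (Bset q :: 'a set) \<subseteq> ?S"
      using card_mono[of ?S "Bset q"] that card_pow_eq_one[of "q\<^sup>2 + q + 1"] by auto
    then obtain a :: 'a where a: "a \<in> Bset q" "a \<notin> ?S" by blast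
    then have "a \<noteq> 0" by (simp add: Bset_def)
    with a(2) have "a ^ (q\<^sup>2 + q + 1) \<noteq> 1" by blast
    then show ?thesis
      using \<open>a \<noteq> 0\<close>
      by (intro bexI[of _ a] conjI Gmap_APN_bij Hmap_APN_bij a(1))
        (simp_all only: diag not_False_eq_True)
  qed
  moreover have "{a::'a. a \<noteq> 0 \<and>
      (diag_equiv (Gmap q a) (Gmap q 1) \<or> diag_equiv (Hmap q a) (Hmap q 1))} = ?S"
    by (intro Collect_cong conj_cong refl) (simp only: diag simp_thms)
  ultimately show ?thesis
    unfolding Let_def
    by (intro conjI allI impI subgroup_pow_eq_one card_pow_eq_one) (simp_all only: diag simp_thms)
qed

end
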